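(* Let $N\ge 1$, let $\alpha=(\alpha^1,\dots,\alpha^N)$ and $\beta=(\beta^1,\dots,\beta^N)$ be vectors in $\mathbb{R}^N$ with all entries strictly positive, let $\gamma_{01},\gamma_{10}\ge 0$ be real numbers, and let $W=(W^i_j)$ be a symmetric real $N\times N$ matrix with non-negative entries and zeros on the diagonal. Consider the system of differential equations $$\frac{dp^i}{dt} = -\alpha^i p^i+\beta^i q^i-\gamma_{01}\,p^i\sum_{j=1}^N W^i_j q^j+\gamma_{10}\,q^i\sum_{j=1}^N W^i_j p^j,\qquad i=1,\dots,N,$$ where $q^i=1-p^i$. Then this system leaves the $N$-dimensional unit cube $[0,1]^N$ invariant, and it possesses a unique globally stable steady state in the interior $(0,1)^N$ of the cube.
   Context: A steady state (equilibrium, fixed point) is a point $\bar p$ at which the right-hand sides of all $N$ equations vanish. Superscripts on $p,q,\alpha,\beta$ are indices, not powers. The system is considered on the state space $[0,1]^N$; invariance means forward invariance: a solution with $p(0)\in[0,1]^N$ remains in $[0,1]^N$ for all $t\ge 0$. Globally stable means that the steady state $\bar p$ is (Lyapunov) stable and every solution with $p(0)\in[0,1]^N$ converges to $\bar p$ as $t\to\infty$. *)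

theory Defs
  imports "HOL-Analysis.Analysis"
begin

definition solves_ode :: "('a::real_normed_vector \<Rightarrow> 'a) \<Rightarrow> real set \<Rightarrow> (real \<Rightarrow> 'a) \<Rightarrow> bool"
  where "solves_ode F J x \<longleftrightarrow> (\<forall>t\<in>J. (x has_vector_derivative F (x t)) (at t within J))"

definition steady_state :: "('a::real_normed_vector \<Rightarrow> 'a) \<Rightarrow> 'a \<Rightarrow> bool"
  where "steady_state F e \<longleftrightarrow> F e = 0"

text \<open>
  Staying in \<open>S\<close> for all \<open>t \<ge> 0\<close> includes that solutions starting in \<open>S\<close> exist for all \<open>t \<ge> 0\<close>.
  The second conjunct also covers solutions given only on a bounded time interval; a solution on
  \<open>{0..}\<close> is covered through its restrictions.
\<close>
definition forward_invariant :: "('a::real_normed_vector \<Rightarrow> 'a) \<Rightarrow> 'a set \<Rightarrow> bool"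
  where "forward_invariant F S \<longleftrightarrow>
    (\<forall>x0\<in>S. \<exists>x. solves_ode F {0..} x \<and> x 0 = x0) \<and>
    (\<forall>T>0. \<forall>x. solves_ode F {0..<T} x \<and> x 0 \<in> S \<longrightarrow> (\<forall>t\<in>{0..<T}. x t \<in> S))"

definition lyapunov_stable :: "('a::real_normed_vector \<Rightarrow> 'a) \<Rightarrow> 'a set \<Rightarrow> 'a \<Rightarrow> bool"
  where "lyapunov_stable F S e \<longleftrightarrow>
    (\<forall>\<epsilon>>0. \<exists>\<delta>>0. \<forall>x. solves_ode F {0..} x \<and> x 0 \<in> S \<and> dist (x 0) e < \<delta> \<longrightarrow>
      (\<forall>t\<ge>0. dist (x t) e < \<epsilon>))"

definition globally_stable :: "('a::real_normed_vector \<Rightarrow> 'a) \<Rightarrow> 'a set \<Rightarrow> 'a \<Rightarrow> bool"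
  where "globally_stable F S e \<longleftrightarrow>
    lyapunov_stable F S e \<and>
    (\<forall>x. solves_ode F {0..} x \<and> x 0 \<in> S \<longrightarrow> (x \<longlongrightarrow> e) at_top)"

text \<open>\<open>W $ i $ j\<close> is the matrix entry with upper index \<open>i\<close> and lower index \<open>j\<close>; \<open>q\<close> is \<open>1 - p\<close>.\<close>
definition network_field ::
    "real^'n \<Rightarrow> real^'n \<Rightarrow> real \<Rightarrow> real \<Rightarrow> real^'n^'n \<Rightarrow> real^'n \<Rightarrow> real^'n"
  where "network_field \<alpha> \<beta> \<gamma>\<^sub>0\<^sub>1 \<gamma>\<^sub>1\<^sub>0 W p =
    (\<chi> i. - \<alpha> $ i * p $ i + \<beta> $ i * (1 - p $ i)
       - \<gamma>\<^sub>0\<^sub>1 * p $ i * (\<Sum>j\<in>UNIV. W $ i $ j * (1 - p $ j))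
       + \<gamma>\<^sub>1\<^sub>0 * (1 - p $ i) * (\<Sum>j\<in>UNIV. W $ i $ j * p $ j))"

end

theory Submission
  imports Defs
begin

text \<open>
  Multiplying out, the \<open>i\<close>-th component of the field is
  \<open>(1 - p $ i) * gain - p $ i * loss\<close>, with rates \<open>gain\<close> and \<open>loss\<close> that are strictly
  positive on the closed cube. Hence the field points inward on every face, and the cube is
  invariant (\<open>unit_cube_invariant_if_inward\<close>). The equation \<open>F p = 0\<close> is
  the fixed point equation \<open>p $ i = gain / (gain + loss)\<close>, whose right-hand side maps the
  closed cube into the open one, so Brouwer's theorem provides a steady state \<open>e\<close> in the interior
  (\<open>interior_steady_state\<close>).

  Stability rests on two properties. The system is cooperative: in the cube, \<open>F p $ i\<close> is
  nondecreasing in \<open>p $ j\<close> for \<open>j \<noteq> i\<close> (\<open>F_diff\<close>), which yields a comparison principle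
  (\<open>quasimonotone_nonneg\<close>). And if \<open>\<gamma>\<^sub>0\<^sub>1 \<le> \<gamma>\<^sub>1\<^sub>0\<close>, it is strictly sublinear along rays
  (\<open>F_scale\<close>): \<open>F (c *\<^sub>R e)\<close> is componentwise negative for \<open>c > 1\<close> and positive for
  \<open>0 \<le> c < 1\<close>. Consequently, for every sufficiently small rate \<open>k\<close>, the points
  \<open>(1 + \<mu> * exp (- k * t)) *\<^sub>R e\<close> are supersolutions for \<open>\<mu> > 0\<close> and subsolutions for
  \<open>-1 \<le> \<mu> < 0\<close> (\<open>ray_barrier\<close>). Every solution in the cube starts between two such barriers, whose
  distance from \<open>e\<close> is proportional to that of the initial value, and is squeezed
  exponentially fast to \<open>e\<close>. This gives Lyapunov stability and convergence at once
  (\<open>steady_state_globally_stable\<close>), and uniqueness follows because another steady state would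
  not converge to \<open>e\<close>.

  If \<open>\<gamma>\<^sub>0\<^sub>1 > \<gamma>\<^sub>1\<^sub>0\<close>, the same argument applies to \<open>q = 1 - p\<close>, which obeys the system with
  \<open>\<alpha>\<close>, \<open>\<beta>\<close> and \<open>\<gamma>\<^sub>0\<^sub>1\<close>, \<open>\<gamma>\<^sub>1\<^sub>0\<close> interchanged (\<open>network_field_reflect\<close>).
\<close>

section \<open>Differential inequalities and uniqueness\<close>

text \<open>
  The function \<open>V t * exp (- K * t)\<close> is nonincreasing, which is the differential form of
  Gronwall's inequality.
\<close>

lemma gronwall_nonpos:
  fixes V V' :: "real \<Rightarrow> real"
  assumes deriv: "\<And>t. 0 \<le> t \<Longrightarrow> t \<le> T \<Longrightarrow> (V has_real_derivative V' t) (at t within {0..T})"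
    and bound: "\<And>t. 0 \<le> t \<Longrightarrow> t \<le> T \<Longrightarrow> V' t \<le> K * V t"
    and V0: "V 0 \<le> 0" and T: "0 \<le> T"
  shows "V T \<le> 0"
proof (cases "T = 0")
  case False
  with T have T: "0 < T" by simp
  define f where "f t = V t * exp (- K * t)" for t
  have f': "(f has_real_derivative (V' t - K * V t) * exp (- K * t)) (at t within {0..T})"
    if "0 \<le> t" "t \<le> T" for t
    unfolding f_def
    by (auto intro!: derivative_eq_intros deriv[OF that] simp: algebra_simps)
  have "\<exists>s\<in>{0<..<T}. f T - f 0 = (*) ((V' s - K * V s) * exp (- K * s)) (T - 0)"
  proof (rule mvt_simple[OF T])
    show "(f has_derivative (*) ((V' t - K * V t) * exp (- K * t))) (at t within {0..T})"
      if "0 \<le> t" "t \<le> T" for t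
      using f'[OF that] by (simp add: has_field_derivative_def)
  qed
  then obtain s where s: "s \<in> {0<..<T}"
    "f T - f 0 = (V' s - K * V s) * exp (- K * s) * (T - 0)" by auto
  have "f T - f 0 \<le> 0"
    unfolding s(2) using s(1) bound[of s] T
    by (intro mult_nonpos_nonneg) (auto intro!: mult_nonpos_nonneg)
  then have "V T * exp (- K * T) \<le> 0"
    using V0 by (simp add: f_def)
  then show ?thesis by (simp add: mult_le_0_iff)
qed (use V0 in simp)

text \<open>
  Squaring removes the kink of the negative part at \<open>0\<close>, so that sums of squared negative
  parts are differentiable Lyapunov functions for positivity statements.
\<close>

lemma min_zero_sq_deriv:
  fixes x :: real
  shows "((\<lambda>x. (min x 0)\<^sup>2) has_real_derivative 2 * min x 0) (at x)"
proof -
  consider "x < 0" | "x > 0" | "x = 0" by linarith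
  then show ?thesis
  proof cases
    case 1
    have "((\<lambda>x. x\<^sup>2) has_real_derivative 2 * x) (at x)"
      by (auto intro!: derivative_eq_intros)
    then have "((\<lambda>x. (min x 0)\<^sup>2) has_real_derivative 2 * x) (at x)"
      by (rule has_field_derivative_transform_within_open[where S = "{..<0}"]) (use 1 in auto)
    with 1 show ?thesis by simp
  next
    case 2
    have "((\<lambda>x. 0) has_real_derivative 0) (at x)" by simp
    then have "((\<lambda>x. (min x 0)\<^sup>2) has_real_derivative 0) (at x)"
      by (rule has_field_derivative_transform_within_open[where S = "{0<..}"]) (use 2 in auto)
    with 2 show ?thesis by simp
  next
    case 3
    have "((\<lambda>h::real. (min h 0)\<^sup>2 / h) \<longlongrightarrow> 0) (at 0)"
    proof (rule Lim_null_comparison)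
      show "\<forall>\<^sub>F h in at 0. norm ((min h 0)\<^sup>2 / h) \<le> \<bar>h::real\<bar>"
        by (intro always_eventually) (auto simp: min_def power2_eq_square)
      show "((\<lambda>h::real. \<bar>h\<bar>) \<longlongrightarrow> 0) (at 0)"
        by (auto intro!: tendsto_eq_intros)
    qed
    then show ?thesis by (simp add: 3 DERIV_def)
  qed
qed

text \<open>
  A comparison principle in the style of Kamke and Mueller. The hypothesis \<open>below\<close> constrains
  a component only while it is negative: its derivative must then be bounded below by
  the negative parts of all components, as happens in a linear differential inequality
  with nonnegative off-diagonal coefficients. Under it, the sum \<open>V\<close> of the squared negative
  parts satisfies \<open>V' \<le> 2 * K * N * V\<close>, where \<open>N\<close> is the number of components, and \<open>V\<close>
  vanishes initially. This serves both for invariance of the cube (with \<open>K = 0\<close>)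
  and for comparing solutions with moving barriers.
\<close>

lemma quasimonotone_nonneg:
  fixes z z' :: "real \<Rightarrow> 'i::finite \<Rightarrow> real"
  assumes deriv: "\<And>t i. 0 \<le> t \<Longrightarrow> t \<le> T \<Longrightarrow>
      ((\<lambda>t. z t i) has_real_derivative z' t i) (at t within {0..T})"
    and below: "\<And>t i. 0 \<le> t \<Longrightarrow> t \<le> T \<Longrightarrow> z t i < 0 \<Longrightarrow>
      z' t i \<ge> K * (\<Sum>j\<in>UNIV. min (z t j) 0)"
    and K: "0 \<le> K" and init: "\<And>i. 0 \<le> z 0 i" and T: "0 \<le> T"
  shows "0 \<le> z T i"
proof -
  define m where "m t j = min (z t j) 0" for t j
  define V where "V t = (\<Sum>j\<in>UNIV. (m t j)\<^sup>2)" for t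
  define N where "N = real (CARD('i))"
  have dV: "(V has_real_derivative (\<Sum>j\<in>UNIV. 2 * m t j * z' t j)) (at t within {0..T})"
    if "0 \<le> t" "t \<le> T" for t
    unfolding V_def m_def
  proof (rule DERIV_sum)
    show "((\<lambda>t. (min (z t j) 0)\<^sup>2) has_real_derivative 2 * min (z t j) 0 * z' t j)
        (at t within {0..T})" for j
      using DERIV_chain2[OF min_zero_sq_deriv deriv[OF that]] by simp
  qed
  have bV: "(\<Sum>j\<in>UNIV. 2 * m t j * z' t j) \<le> (2 * K * N) * V t"
    if t: "0 \<le> t" "t \<le> T" for t
  proof -
    have "m t j * z' t j \<le> m t j * (K * (\<Sum>k\<in>UNIV. m t k))" for j
    proof (cases "z t j < 0")
      case True
      then show ?thesis using below[OF t True]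
        by (intro mult_left_mono_neg) (auto simp: m_def)
    qed (simp add: m_def)
    then have "(\<Sum>j\<in>UNIV. m t j * z' t j) \<le> (\<Sum>j\<in>UNIV. m t j * (K * (\<Sum>k\<in>UNIV. m t k)))"
      by (rule sum_mono)
    also have "\<dots> = K * (\<Sum>j\<in>UNIV. m t j)\<^sup>2"
      by (simp add: sum_distrib_right[symmetric] power2_eq_square)
    also have "\<dots> \<le> K * (N * V t)"
      unfolding N_def V_def using K sum_squared_le_sum_of_squares[of "m t" UNIV]
      by (intro mult_left_mono) (simp_all add: mult.commute)
    finally show ?thesis
      by (simp add: mult.assoc flip: sum_distrib_left)
  qed
  have "V 0 \<le> 0" using init by (simp add: V_def m_def min_absorb2)
  from gronwall_nonpos[OF dV bV this T] have "V T \<le> 0" .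
  moreover have "(m T i)\<^sup>2 \<le> V T"
    unfolding V_def by (rule member_le_sum) auto
  ultimately have "(m T i)\<^sup>2 \<le> 0" by linarith
  then have "m T i = 0" by simp
  then show ?thesis by (simp add: m_def min_def split: if_splits)
qed

lemma solves_ode_subset:
  "solves_ode F J x \<Longrightarrow> I \<subseteq> J \<Longrightarrow> solves_ode F I x"
  unfolding solves_ode_def using has_vector_derivative_within_subset by blast

text \<open>
  Only the Lipschitz constant on a set containing both trajectories enters, so the lemma
  applies to polynomial vector fields, which in general are Lipschitz on bounded sets only.
\<close>

lemma solves_ode_unique:
  fixes F :: "'a::real_inner \<Rightarrow> 'a"
  assumes x: "solves_ode F {0..T} x" and y: "solves_ode F {0..T} y"
    and lip: "L-lipschitz_on S F"
    and S: "x ` {0..T} \<subseteq> S" "y ` {0..T} \<subseteq> S"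
    and init: "x 0 = y 0" and T: "0 \<le> T"
  shows "x T = y T"
proof -
  define V where "V t = (x t - y t) \<bullet> (x t - y t)" for t
  have dV: "(V has_real_derivative 2 * ((x t - y t) \<bullet> (F (x t) - F (y t)))) (at t within {0..T})"
    if "0 \<le> t" "t \<le> T" for t
  proof -
    have "((\<lambda>t. x t - y t) has_vector_derivative F (x t) - F (y t)) (at t within {0..T})"
      using x y that by (auto simp: solves_ode_def intro!: has_vector_derivative_diff)
    from bounded_bilinear.has_vector_derivative[OF bounded_bilinear_inner this this]
    show ?thesis
      by (simp add: V_def[abs_def] has_real_derivative_iff_has_vector_derivative inner_commute)
  qed
  have bV: "2 * ((x t - y t) \<bullet> (F (x t) - F (y t))) \<le> (2 * L) * V t" if "0 \<le> t" "t \<le> T" for t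
  proof -
    have "(x t - y t) \<bullet> (F (x t) - F (y t)) \<le> norm (x t - y t) * norm (F (x t) - F (y t))"
      by (rule norm_cauchy_schwarz)
    also have "\<dots> \<le> norm (x t - y t) * (L * norm (x t - y t))"
      using that S by (intro mult_left_mono lipschitz_on_normD[OF lip]) auto
    also have "\<dots> = L * V t"
      by (simp add: V_def power2_norm_eq_inner[symmetric] power2_eq_square)
    finally show ?thesis by simp
  qed
  have "V T \<le> 0"
    by (rule gronwall_nonpos[OF dV bV]) (use init T in \<open>auto simp: V_def\<close>)
  then show ?thesis by (simp add: V_def power2_norm_eq_inner[symmetric])
qed

section \<open>Global existence for bounded Lipschitz fields\<close>

text \<open>
  The fundamental theorem on a half-line, where the endpoint \<open>a\<close> still has only a
  one-sided derivative.
\<close>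

lemma integral_has_vector_derivative_atLeast:
  fixes g :: "real \<Rightarrow> 'a::banach"
  assumes "continuous_on {a..} g" and "a \<le> t"
  shows "((\<lambda>u. integral {a..u} g) has_vector_derivative g t) (at t within {a..})"
proof -
  have "((\<lambda>u. integral {a..u} g) has_vector_derivative g t) (at t within {a..t+1})"
    by (rule integral_has_vector_derivative) (use assms in \<open>auto intro: continuous_on_subset\<close>)
  moreover have "at t within {a..t+1} = at t within {a..}"
    by (rule at_within_nhd[of t "{..<t+1}"]) auto
  ultimately show ?thesis by simp
qed

text \<open>
  Global Picard-Lindeloef theorem by a single application of Banach's fixed point theorem.
  Writing the solution as \<open>x t = x0 + exp (2 * l * t) *\<^sub>R u t\<close> turns the integral equation
  into a fixed point equation for \<open>u\<close>. The exponential weight (Bielecki's trick) makes the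
  integral operator a contraction with factor \<open>1/2\<close> on all of \<open>{0..}\<close>, so no gluing of local
  solutions is necessary; boundedness of \<open>G\<close> makes the operator preserve bounded functions.
\<close>

lemma bounded_lipschitz_ode_solution:
  fixes G :: "'a::banach \<Rightarrow> 'a"
  assumes lip: "L-lipschitz_on UNIV G" and bdd: "bounded (range G)"
  obtains x where "solves_ode G {0..} x" "x 0 = x0"
proof -
  obtain M where M: "norm (G y) \<le> M" for y
    using bdd by (auto simp: bounded_iff)
  have M0: "0 \<le> M" using M[of undefined] norm_ge_zero order_trans by blast
  \<comment> \<open>The weight has to decay, so the rate must be positive even if \<open>L = 0\<close>.\<close>
  define l where "l = L + 1"
  have l: "0 < l" using lipschitz_on_nonneg[OF lip] by (simp add: l_def)
  have lip_l: "norm (G y - G z) \<le> l * norm (y - z)" for y z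
  proof -
    have "norm (G y - G z) \<le> L * norm (y - z)"
      by (rule lipschitz_on_normD[OF lip]) auto
    also have "\<dots> \<le> l * norm (y - z)"
      by (intro mult_right_mono) (auto simp: l_def)
    finally show ?thesis .
  qed
  define g where "g u s = G (x0 + exp (2 * l * s) *\<^sub>R apply_bcontfun u s)"
    for u :: "real \<Rightarrow>\<^sub>C 'a" and s
  define I where "I u t = integral {0..t} (g u)" for u t
  \<comment> \<open>Bounded continuous functions live on the whole line; negative times are frozen at \<open>0\<close>.\<close>
  define P where "P u t = exp (- (2 * l * max t 0)) *\<^sub>R I u (max t 0)" for u t
  have contG: "continuous_on UNIV G"
    using lip by (rule lipschitz_on_continuous_on)
  have contg: "continuous_on S (g u)" for u S
    unfolding g_def
    by (intro continuous_on_compose2[OF contG] continuous_intros) auto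
  have intg: "g u integrable_on {0..t}" for u t
    using contg by (rule integrable_continuous_real)
  have I_deriv: "(I u has_vector_derivative g u t) (at t within {0..})" if "0 \<le> t" for u t
    unfolding I_def by (rule integral_has_vector_derivative_atLeast[OF contg that])
  have contI: "continuous_on {0..} (I u)" for u
    unfolding continuous_on_eq_continuous_within
    using has_vector_derivative_continuous[OF I_deriv] by auto
  have contP: "continuous_on UNIV (P u)" for u
    unfolding P_def by (intro continuous_intros continuous_on_compose2[OF contI]) auto
  have bddP: "norm (P u t) \<le> M / (2 * l)" for u t
  proof -
    define s where "s = max t 0"
    have s: "0 \<le> s" by (simp add: s_def)
    have "norm (I u s) \<le> integral {0..s} (\<lambda>_. M)"
      unfolding I_def by (rule integral_norm_bound_integral[OF intg]) (auto simp: g_def M)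
    also have "\<dots> = M * s" using s by simp
    finally have "norm (P u t) \<le> exp (- (2 * l * s)) * (M * s)"
      by (simp add: P_def flip: s_def)
    \<comment> \<open>The weight beats the linear growth of the integral, because \<open>y * exp (- y) \<le> 1\<close>.\<close>
    also have "\<dots> = M / (2 * l) * ((2 * l * s) * exp (- (2 * l * s)))"
      using l by simp
    also have "\<dots> \<le> M / (2 * l) * 1"
    proof (rule mult_left_mono)
      have "2 * l * s \<le> exp (2 * l * s)"
        using exp_ge_add_one_self[of "2 * l * s"] by linarith
      then show "(2 * l * s) * exp (- (2 * l * s)) \<le> 1"
        by (simp add: exp_minus divide_simps)
    qed (use M0 l in simp)
    finally show ?thesis by simp
  qed
  have P_bcont: "P u \<in> bcontfun" for u
    using contP bddP by (auto simp: bcontfun_def bounded_iff)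
  have P_apply: "apply_bcontfun (Bcontfun (P u)) = P u" for u
    using P_bcont by (rule Bcontfun_inverse)
  have contr: "dist (Bcontfun (P u)) (Bcontfun (P v)) \<le> 1/2 * dist u v" for u v
  proof (rule dist_bound, unfold P_apply)
    fix t :: real
    define s where "s = max t 0"
    have s: "0 \<le> s" by (simp add: s_def)
    let ?d = "dist u v"
    let ?h = "\<lambda>r. l * exp (2 * l * r) * ?d"
    have h: "(?h has_integral (exp (2 * l * s) * ?d / 2 - exp (2 * l * 0) * ?d / 2)) {0..s}"
      by (rule fundamental_theorem_of_calculus[OF s])
        (auto simp flip: has_real_derivative_iff_has_vector_derivative
          intro!: derivative_eq_intros)
    have "norm (I u s - I v s) = norm (integral {0..s} (\<lambda>r. g u r - g v r))"
      unfolding I_def by (simp add: integral_diff intg)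
    also have "\<dots> \<le> integral {0..s} ?h"
    proof (rule integral_norm_bound_integral)
      show "(\<lambda>r. g u r - g v r) integrable_on {0..s}"
        by (intro integrable_diff intg)
      show "?h integrable_on {0..s}" using h by blast
      fix r
      have "norm (g u r - g v r) \<le> l * norm (exp (2 * l * r) *\<^sub>R (apply_bcontfun u r - apply_bcontfun v r))"
        unfolding g_def using lip_l by (metis add_diff_cancel_left scaleR_right_diff_distrib)
      also have "\<dots> = l * exp (2 * l * r) * dist (apply_bcontfun u r) (apply_bcontfun v r)"
        by (simp add: dist_norm)
      also have "\<dots> \<le> ?h r"
        using l by (intro mult_left_mono dist_bounded) auto
      finally show "norm (g u r - g v r) \<le> ?h r" .
    qed
    also have "\<dots> \<le> exp (2 * l * s) * ?d / 2"
      using integral_unique[OF h] by simp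
    finally have *: "norm (I u s - I v s) \<le> exp (2 * l * s) * ?d / 2" .
    have "dist (P u t) (P v t) = exp (- (2 * l * s)) * norm (I u s - I v s)"
      by (simp add: P_def dist_norm flip: s_def scaleR_right_diff_distrib)
    also have "\<dots> \<le> exp (- (2 * l * s)) * (exp (2 * l * s) * ?d / 2)"
      using * by (intro mult_left_mono) auto
    also have "\<dots> = 1/2 * ?d"
      by (simp add: exp_minus)
    finally show "dist (P u t) (P v t) \<le> 1/2 * ?d" .
  qed
  obtain u where "Bcontfun (P u) = u"
    using banach_fix_type[of "1/2" "\<lambda>u. Bcontfun (P u)"] contr by auto
  then have u: "apply_bcontfun u = P u" by (metis P_apply)
  define x where "x t = x0 + I u t" for t
  have x_eq: "x t = x0 + exp (2 * l * t) *\<^sub>R apply_bcontfun u t" if "0 \<le> t" for t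
    using that by (simp add: u x_def P_def max_def exp_minus)
  have "solves_ode G {0..} x"
    unfolding solves_ode_def
  proof
    fix t :: real assume "t \<in> {0..}"
    then have t: "0 \<le> t" by simp
    have "(x has_vector_derivative g u t) (at t within {0..})"
      unfolding x_def[abs_def] using I_deriv[OF t, of u]
      by (auto intro!: derivative_eq_intros)
    then show "(x has_vector_derivative G (x t)) (at t within {0..})"
      by (simp add: g_def x_eq[OF t])
  qed
  moreover have "x 0 = x0" by (simp add: x_def I_def)
  ultimately show thesis by (rule that)
qed

section \<open>Invariance of the unit cube\<close>

lemma mem_unit_cube:
  fixes x :: "real^'n"
  shows "x \<in> cbox 0 1 \<longleftrightarrow> (\<forall>i. 0 \<le> x $ i \<and> x $ i \<le> 1)"
    and "x \<in> box 0 1 \<longleftrightarrow> (\<forall>i. 0 < x $ i \<and> x $ i < 1)"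
  by (simp_all add: mem_box_cart)

lemma solves_ode_nth_deriv:
  assumes "solves_ode F J x" "t \<in> J"
  shows "((\<lambda>t. x t $ i) has_real_derivative F (x t) $ i) (at t within J)"
  using bounded_linear.has_vector_derivative[OF bounded_linear_vec_nth, of x "F (x t)" "at t within J" i] assms
  by (simp add: solves_ode_def has_real_derivative_iff_has_vector_derivative)

lemma solves_ode_continuous_on:
  "solves_ode F J x \<Longrightarrow> continuous_on J x"
  unfolding solves_ode_def continuous_on_eq_continuous_within
  using has_vector_derivative_continuous by blast

lemma clamp_unit_cube_nth:
  fixes x :: "real^'n"
  shows "clamp 0 1 x $ i = max 0 (min 1 (x $ i))"
proof -
  have le: "\<forall>b\<in>Basis. (0::real^'n) \<bullet> b \<le> 1 \<bullet> b"
    by (auto simp: Basis_vec_def inner_axis)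
  have b: "axis i 1 \<in> (Basis :: (real^'n) set)" by simp
  have "clamp 0 1 x \<bullet> axis i 1 =
    (if x \<bullet> axis i 1 < 0 then 0 else
      if x \<bullet> axis i 1 \<le> (1::real^'n) \<bullet> axis i 1 then x \<bullet> axis i 1 else (1::real^'n) \<bullet> axis i 1)"
    unfolding clamp_def using le b by auto
  then show ?thesis
    by (auto simp: inner_axis)
qed

lemma clamp_unit_cube_mem: "clamp 0 1 (x :: real^'n) \<in> cbox 0 1"
  by (simp add: mem_unit_cube clamp_unit_cube_nth)

text \<open>
  Existence and invariance are obtained together. Composing the field with the projection
  \<open>clamp\<close> onto the cube gives a bounded and globally Lipschitz field \<open>G\<close>, which has
  solutions for all times. Outside the cube the clamped coordinate sits on a face, where \<open>F\<close>
  does not point outward; hence solutions of \<open>G\<close> stay in the cube, where \<open>G = F\<close>. Any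
  other solution of \<open>F\<close> with the same initial value coincides with this one by uniqueness.
\<close>

lemma unit_cube_invariant_if_inward:
  fixes F :: "real^'n \<Rightarrow> real^'n"
  assumes lip: "\<And>R. \<exists>L. L-lipschitz_on (cball 0 R) F"
    and inward0: "\<And>p i. p \<in> cbox 0 1 \<Longrightarrow> p $ i = 0 \<Longrightarrow> 0 \<le> F p $ i"
    and inward1: "\<And>p i. p \<in> cbox 0 1 \<Longrightarrow> p $ i = 1 \<Longrightarrow> F p $ i \<le> 0"
  shows "forward_invariant F (cbox 0 1)"
proof -
  have exist: "\<exists>x. solves_ode F {0..} x \<and> x 0 = x0 \<and> (\<forall>t\<ge>0. x t \<in> cbox 0 1)"
    if x0: "x0 \<in> cbox 0 1" for x0
  proof -
    define G where "G p = F (clamp 0 1 p)" for p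
    have "\<exists>R. cbox 0 1 \<subseteq> cball (0::real^'n) R"
      using bounded_cbox[of "0::real^'n" 1] by (simp add: bounded_iff subset_eq)
    then obtain R where R: "cbox 0 1 \<subseteq> cball (0::real^'n) R" ..
    obtain L where L: "L-lipschitz_on (cball 0 R) F" using lip by blast
    have LG: "L-lipschitz_on UNIV G"
    proof (rule lipschitz_onI)
      fix p q :: "real^'n"
      have "dist (G p) (G q) \<le> L * dist (clamp 0 1 p) (clamp 0 1 q)"
        unfolding G_def
        by (intro lipschitz_onD[OF L] subsetD[OF R] clamp_unit_cube_mem)
      also have "\<dots> \<le> L * dist p q"
        by (intro mult_left_mono dist_clamps_le_dist_args lipschitz_on_nonneg[OF L])
      finally show "dist (G p) (G q) \<le> L * dist p q" .
    qed (rule lipschitz_on_nonneg[OF L])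
    have "continuous_on (cbox 0 1) F"
      using lipschitz_on_continuous_on[OF L] R by (rule continuous_on_subset)
    then have "bounded (F ` cbox 0 1)"
      by (intro compact_imp_bounded compact_continuous_image compact_cbox)
    then have bG: "bounded (range G)"
      unfolding G_def by (rule clamp_bounded)
    obtain x where x: "solves_ode G {0..} x" "x 0 = x0"
      using bounded_lipschitz_ode_solution[OF LG bG] by blast
    have xT: "solves_ode G {0..t} x" for t
      using x(1) by (rule solves_ode_subset) auto
    have in_cube: "x t \<in> cbox 0 1" if t: "0 \<le> t" for t
      unfolding mem_unit_cube
    proof (intro allI conjI)
      fix i
      show "0 \<le> x t $ i"
      proof (rule quasimonotone_nonneg[where K = 0 and T = t and z = "\<lambda>s i. x s $ i"
            and z' = "\<lambda>s i. G (x s) $ i"])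
        show "((\<lambda>t. x t $ i) has_real_derivative G (x s) $ i) (at s within {0..t})"
          if "0 \<le> s" "s \<le> t" for s i
          by (rule solves_ode_nth_deriv[OF xT]) (use that in auto)
        show "0 * (\<Sum>j\<in>UNIV. min (x s $ j) 0) \<le> G (x s) $ i" if "x s $ i < 0" for s i
          using that inward0[OF clamp_unit_cube_mem, of "x s" i]
          by (simp add: G_def clamp_unit_cube_nth)
        show "0 \<le> x 0 $ i" for i using x0 x(2) by (simp add: mem_unit_cube)
      qed (use t in auto)
      have "0 \<le> 1 - x t $ i"
      proof (rule quasimonotone_nonneg[where K = 0 and T = t and z = "\<lambda>s i. 1 - x s $ i"
            and z' = "\<lambda>s i. - G (x s) $ i"])
        show "((\<lambda>t. 1 - x t $ i) has_real_derivative - G (x s) $ i) (at s within {0..t})"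
          if "0 \<le> s" "s \<le> t" for s i
          using solves_ode_nth_deriv[OF xT, of s t i] that
          by (auto intro!: derivative_eq_intros)
        show "0 * (\<Sum>j\<in>UNIV. min (1 - x s $ j) 0) \<le> - G (x s) $ i" if "1 - x s $ i < 0" for s i
          using that inward1[OF clamp_unit_cube_mem, of "x s" i]
          by (simp add: G_def clamp_unit_cube_nth)
        show "0 \<le> 1 - x 0 $ i" for i using x0 x(2) by (simp add: mem_unit_cube)
      qed (use t in auto)
      then show "x t $ i \<le> 1" by simp
    qed
    have "G (x t) = F (x t)" if "0 \<le> t" for t
    proof -
      have "clamp 0 1 (x t) = x t"
        using in_cube[OF that] by (auto simp: vec_eq_iff clamp_unit_cube_nth mem_unit_cube)
      then show ?thesis by (simp add: G_def)
    qed
    then have "solves_ode F {0..} x"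
      using x(1) by (simp add: solves_ode_def)
    with in_cube x(2) show ?thesis by blast
  qed
  have stay: "y t \<in> cbox 0 1"
    if y: "solves_ode F {0..<T} y" "y 0 \<in> cbox 0 1" and t: "t \<in> {0..<T}" for y T t
  proof -
    obtain x where x: "solves_ode F {0..} x" "x 0 = y 0" "\<And>t. 0 \<le> t \<Longrightarrow> x t \<in> cbox 0 1"
      using exist[OF y(2)] by blast
    have xt: "solves_ode F {0..t} x" by (rule solves_ode_subset[OF x(1)]) auto
    have yt: "solves_ode F {0..t} y" by (rule solves_ode_subset[OF y(1)]) (use t in auto)
    have "compact (x ` {0..t} \<union> y ` {0..t})"
      using xt yt by (intro compact_Un compact_continuous_image solves_ode_continuous_on) auto
    then have "bounded (x ` {0..t} \<union> y ` {0..t})" by (rule compact_imp_bounded)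
    then obtain R where R: "\<forall>z \<in> x ` {0..t} \<union> y ` {0..t}. norm z \<le> R"
      unfolding bounded_iff by blast
    obtain L where L: "L-lipschitz_on (cball 0 R) F" using lip by blast
    have "x t = y t"
      by (rule solves_ode_unique[OF xt yt L]) (use R x(2) t in auto)
    then show ?thesis using x(3)[of t] t by auto
  qed
  show ?thesis
    unfolding forward_invariant_def using exist stay by blast
qed

lemma forward_invariantD:
  assumes "forward_invariant F S" "solves_ode F {0..} x" "x 0 \<in> S" "0 \<le> t"
  shows "x t \<in> S"
proof -
  have "solves_ode F {0..<t + 1} x"
    using assms(2) by (rule solves_ode_subset) auto
  then show ?thesis
    using assms unfolding forward_invariant_def
    by (meson add_nonneg_pos atLeastLessThan_iff less_add_one zero_less_one)
qed

section \<open>Criteria for global stability\<close>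

text \<open>
  A linear bound in the initial distance gives stability with \<open>\<delta> = \<epsilon> / C\<close>, and the
  exponential factor gives convergence.
\<close>

lemma globally_stable_if_exponential:
  assumes k: "0 < k" and C: "0 < C"
    and decay: "\<And>x t. solves_ode F {0..} x \<Longrightarrow> x 0 \<in> S \<Longrightarrow> 0 \<le> t \<Longrightarrow>
      dist (x t) e \<le> C * dist (x 0) e * exp (- k * t)"
  shows "globally_stable F S e"
  unfolding globally_stable_def lyapunov_stable_def
proof (intro conjI allI impI)
  fix \<epsilon> :: real assume \<epsilon>: "0 < \<epsilon>"
  show "\<exists>\<delta>>0. \<forall>x. solves_ode F {0..} x \<and> x 0 \<in> S \<and> dist (x 0) e < \<delta> \<longrightarrow>
      (\<forall>t\<ge>0. dist (x t) e < \<epsilon>)"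
  proof (intro exI[of _ "\<epsilon> / C"] conjI allI impI)
    fix x t assume x: "solves_ode F {0..} x \<and> x 0 \<in> S \<and> dist (x 0) e < \<epsilon> / C" and t: "(0::real) \<le> t"
    have "dist (x t) e \<le> C * dist (x 0) e * exp (- k * t)"
      using decay x t by blast
    also have "\<dots> \<le> C * dist (x 0) e"
      using C k t by (intro mult_left_le) auto
    also have "\<dots> < \<epsilon>"
      using x C by (simp add: field_simps)
    finally show "dist (x t) e < \<epsilon>" .
  qed (use \<epsilon> C in simp)
next
  fix x assume x: "solves_ode F {0..} x \<and> x 0 \<in> S"
  have "filterlim (\<lambda>t. - k * t) at_bot at_top"
    by (rule filterlim_tendsto_neg_mult_at_bot[OF tendsto_const _ filterlim_ident]) (use k in simp)
  then have "((\<lambda>t. exp (- k * t)) \<longlongrightarrow> 0) at_top"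
    by (rule filterlim_compose[OF exp_at_bot])
  then have lim: "((\<lambda>t. C * dist (x 0) e * exp (- k * t)) \<longlongrightarrow> 0) at_top"
    by (rule tendsto_mult_right_zero)
  have "((\<lambda>t. dist (x t) e) \<longlongrightarrow> 0) at_top"
  proof (rule tendsto_0_le[OF lim, of _ 1])
    show "\<forall>\<^sub>F t in at_top. norm (dist (x t) e) \<le> norm (C * dist (x 0) e * exp (- k * t)) * 1"
      using eventually_ge_at_top[of "0::real"]
    proof eventually_elim
      case (elim t)
      have "dist (x t) e \<le> C * dist (x 0) e * exp (- k * t)"
        using decay x elim by blast
      also have "\<dots> \<le> norm (C * dist (x 0) e * exp (- k * t)) * 1"
        unfolding real_norm_def mult_1_right by (rule abs_ge_self)
      finally show ?case
        unfolding real_norm_def abs_of_nonneg[OF zero_le_dist] .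
    qed
  qed
  then show "(x \<longlongrightarrow> e) at_top"
    by (subst tendsto_dist_iff)
qed

text \<open>
  Point reflection \<open>p \<mapsto> c - p\<close> is an isometry and maps solutions to solutions. It will be used
  to exchange the roles of \<open>p\<close> and \<open>q = 1 - p\<close>.
\<close>

lemma globally_stable_reflect:
  fixes F :: "'a::real_normed_vector \<Rightarrow> 'a"
  assumes stable: "globally_stable F' S e" and conj: "\<And>p. F' (c - p) = - F p"
    and S: "\<And>p. p \<in> S \<Longrightarrow> c - p \<in> S"
  shows "globally_stable F S (c - e)"
proof -
  have refl: "solves_ode F' {0..} (\<lambda>t. c - x t)" if "solves_ode F {0..} x" for x
    using that by (auto simp: solves_ode_def conj intro!: derivative_eq_intros)
  have dist: "dist (c - p) e = dist p (c - e)" for p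
    using norm_minus_commute[of "c - e" p] by (simp add: dist_norm algebra_simps)
  show ?thesis
    unfolding globally_stable_def
  proof (intro conjI allI impI)
    show "lyapunov_stable F S (c - e)"
      unfolding lyapunov_stable_def
    proof (intro allI impI)
      fix \<epsilon> :: real assume "0 < \<epsilon>"
      with stable obtain \<delta> where \<delta>: "0 < \<delta>"
        "\<And>x t. \<lbrakk>solves_ode F' {0..} x; x 0 \<in> S; dist (x 0) e < \<delta>; 0 \<le> t\<rbrakk> \<Longrightarrow> dist (x t) e < \<epsilon>"
        unfolding globally_stable_def lyapunov_stable_def by blast
      show "\<exists>\<delta>>0. \<forall>x. solves_ode F {0..} x \<and> x 0 \<in> S \<and> dist (x 0) (c - e) < \<delta> \<longrightarrow>
          (\<forall>t\<ge>0. dist (x t) (c - e) < \<epsilon>)"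
        using \<delta>(1) \<delta>(2)[OF refl] S dist by metis
    qed
    fix x assume x: "solves_ode F {0..} x \<and> x 0 \<in> S"
    then have "((\<lambda>t. c - x t) \<longlongrightarrow> e) at_top"
      using stable refl S by (auto simp: globally_stable_def)
    then have "((\<lambda>t. c - (c - x t)) \<longlongrightarrow> c - e) at_top"
      by (intro tendsto_intros)
    then show "(x \<longlongrightarrow> c - e) at_top" by simp
  qed
qed

text \<open>
  A second steady state would be a constant solution, which has to converge to the first.
\<close>

lemma globally_stable_steady_state_unique:
  assumes "globally_stable F S e" "e' \<in> S" "steady_state F e'"
  shows "e' = e"
proof -
  have "solves_ode F {0..} (\<lambda>_. e')"
    using assms(3) by (auto simp: solves_ode_def steady_state_def)
  then have "((\<lambda>_::real. e') \<longlongrightarrow> e) at_top"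
    using assms(1,2) by (auto simp: globally_stable_def)
  then show ?thesis by (simp add: tendsto_const_iff)
qed

section \<open>The network as a cooperative system\<close>

text \<open>
  The locale is instantiated twice: with the given data, and with \<open>\<alpha>\<close>, \<open>\<beta>\<close> and
  \<open>\<gamma>\<^sub>0\<^sub>1\<close>, \<open>\<gamma>\<^sub>1\<^sub>0\<close> interchanged, which describes the evolution of \<open>q\<close>.
\<close>

locale cooperative_network =
  fixes \<alpha> \<beta> :: "real^'n" and \<gamma>\<^sub>0\<^sub>1 \<gamma>\<^sub>1\<^sub>0 :: real and W :: "real^'n^'n"
  assumes \<alpha>_pos: "\<And>i. \<alpha> $ i > 0"
    and \<beta>_pos: "\<And>i. \<beta> $ i > 0"
    and \<gamma>\<^sub>0\<^sub>1_nonneg: "\<gamma>\<^sub>0\<^sub>1 \<ge> 0"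
    and \<gamma>\<^sub>1\<^sub>0_nonneg: "\<gamma>\<^sub>1\<^sub>0 \<ge> 0"
    and W_nonneg: "\<And>i j. W $ i $ j \<ge> 0"
begin

abbreviation "F \<equiv> network_field \<alpha> \<beta> \<gamma>\<^sub>0\<^sub>1 \<gamma>\<^sub>1\<^sub>0 W"

definition gain :: "real^'n \<Rightarrow> 'n \<Rightarrow> real"
  where "gain p i = \<beta> $ i + \<gamma>\<^sub>1\<^sub>0 * (W *v p) $ i"

definition loss :: "real^'n \<Rightarrow> 'n \<Rightarrow> real"
  where "loss p i = \<alpha> $ i + \<gamma>\<^sub>0\<^sub>1 * (W *v (1 - p)) $ i"

text \<open>
  Each coordinate is a two-state process with state-dependent rates. Both the inward direction on
  the faces and the fixed point form of the steady state equation are read off from this form.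
\<close>

lemma F_nth: "F p $ i = (1 - p $ i) * gain p i - p $ i * loss p i"
  by (simp add: network_field_def gain_def loss_def matrix_vector_mult_def algebra_simps)

lemma W_mult_nonneg: "(\<And>j. 0 \<le> p $ j) \<Longrightarrow> 0 \<le> (W *v p) $ i"
  by (simp add: matrix_vector_mult_def W_nonneg sum_nonneg)

lemma
  assumes "p \<in> cbox 0 1"
  shows gain_pos: "0 < gain p i" and loss_pos: "0 < loss p i"
  using assms unfolding gain_def loss_def
  by (auto intro!: add_pos_nonneg mult_nonneg_nonneg W_mult_nonneg
      simp: \<alpha>_pos \<beta>_pos \<gamma>\<^sub>0\<^sub>1_nonneg \<gamma>\<^sub>1\<^sub>0_nonneg mem_unit_cube)

text \<open>
  The field has no terms beyond second order, so its increments are exactly linear in \<open>y - x\<close>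
  with coefficients evaluated at \<open>x\<close> or \<open>y\<close>. The grouping is chosen such that the coupling
  coefficient \<open>\<gamma>\<^sub>1\<^sub>0 * (1 - x $ i) + \<gamma>\<^sub>0\<^sub>1 * x $ i\<close> involves \<open>x\<close> alone: it is nonnegative as soon
  as \<open>x\<close> lies in the cube (cooperativity), wherever \<open>y\<close> may be.
\<close>

lemma F_diff:
  "F y $ i - F x $ i =
     - (\<alpha> $ i + \<beta> $ i + \<gamma>\<^sub>0\<^sub>1 * (W *v 1) $ i + (\<gamma>\<^sub>1\<^sub>0 - \<gamma>\<^sub>0\<^sub>1) * (W *v y) $ i) * (y $ i - x $ i)
     + (\<gamma>\<^sub>1\<^sub>0 * (1 - x $ i) + \<gamma>\<^sub>0\<^sub>1 * x $ i) * (W *v (y - x)) $ i"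
  by (simp add: F_nth gain_def loss_def matrix_vector_mult_diff_distrib algebra_simps)

text \<open>
  Along rays in the positive orthant the field is strictly sublinear if \<open>\<gamma>\<^sub>0\<^sub>1 \<le> \<gamma>\<^sub>1\<^sub>0\<close>:
  the constant inflow \<open>\<beta>\<close> does not scale with \<open>c\<close>, and the quadratic term has a nonpositive
  sign. This is what forces convergence to a steady state \<open>e\<close>.
\<close>

lemma F_scale:
  "F (c *\<^sub>R e) $ i - c * F e $ i =
     (1 - c) * (\<beta> $ i + (\<gamma>\<^sub>1\<^sub>0 - \<gamma>\<^sub>0\<^sub>1) * c * (e $ i * (W *v e) $ i))"
  by (simp add: F_nth gain_def loss_def matrix_vector_mult_diff_distrib
      matrix_vector_mult_scaleR algebra_simps)

lemma F_lipschitz: "\<exists>L. L-lipschitz_on (cball 0 R) F"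
proof -
  obtain K where K: "0 \<le> K" "\<And>x. norm (W *v x) \<le> norm x * K"
    using bounded_linear.nonneg_bounded[OF matrix_vector_mul_bounded_linear[of W]] by blast
  \<comment> \<open>The absolute value of \<open>R\<close> keeps the constants nonnegative when the ball is empty.\<close>
  define C where "C i = \<bar>\<alpha> $ i + \<beta> $ i + \<gamma>\<^sub>0\<^sub>1 * (W *v 1) $ i\<bar> + \<bar>\<gamma>\<^sub>1\<^sub>0 - \<gamma>\<^sub>0\<^sub>1\<bar> * (\<bar>R\<bar> * K)
    + (\<gamma>\<^sub>1\<^sub>0 * (1 + \<bar>R\<bar>) + \<gamma>\<^sub>0\<^sub>1 * \<bar>R\<bar>) * K" for i
  have WK: "\<bar>(W *v x) $ i\<bar> \<le> norm x * K" for x i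
    using component_le_norm_cart[of "W *v x" i] K(2)[of x] by linarith
  have "(\<Sum>i\<in>UNIV. C i)-lipschitz_on (cball 0 R) F"
  proof (rule lipschitz_onI)
    fix y x :: "real^'n" assume xy: "y \<in> cball 0 R" "x \<in> cball 0 R"
    have "\<bar>F y $ i - F x $ i\<bar> \<le> C i * norm (y - x)" for i
    proof -
      have x: "\<bar>x $ i\<bar> \<le> \<bar>R\<bar>"
        using xy(2) component_le_norm_cart[of x i] by simp
      have "\<bar>(W *v y) $ i\<bar> \<le> norm y * K" by (rule WK)
      also have "\<dots> \<le> \<bar>R\<bar> * K" using xy(1) K(1) by (intro mult_right_mono) auto
      finally have y: "\<bar>(W *v y) $ i\<bar> \<le> \<bar>R\<bar> * K" .
      have "\<bar>(\<gamma>\<^sub>1\<^sub>0 - \<gamma>\<^sub>0\<^sub>1) * (W *v y) $ i\<bar> \<le> \<bar>\<gamma>\<^sub>1\<^sub>0 - \<gamma>\<^sub>0\<^sub>1\<bar> * (\<bar>R\<bar> * K)"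
        unfolding abs_mult using y by (intro mult_left_mono) auto
      then have A: "\<bar>\<alpha> $ i + \<beta> $ i + \<gamma>\<^sub>0\<^sub>1 * (W *v 1) $ i + (\<gamma>\<^sub>1\<^sub>0 - \<gamma>\<^sub>0\<^sub>1) * (W *v y) $ i\<bar>
          \<le> \<bar>\<alpha> $ i + \<beta> $ i + \<gamma>\<^sub>0\<^sub>1 * (W *v 1) $ i\<bar> + \<bar>\<gamma>\<^sub>1\<^sub>0 - \<gamma>\<^sub>0\<^sub>1\<bar> * (\<bar>R\<bar> * K)"
        by (rule order_trans[OF abs_triangle_ineq add_mono[OF order_refl]])
      have yx: "\<bar>y $ i - x $ i\<bar> \<le> norm (y - x)"
        using component_le_norm_cart[of "y - x" i] by simp
      have 1: "\<bar>- (\<alpha> $ i + \<beta> $ i + \<gamma>\<^sub>0\<^sub>1 * (W *v 1) $ i + (\<gamma>\<^sub>1\<^sub>0 - \<gamma>\<^sub>0\<^sub>1) * (W *v y) $ i) * (y $ i - x $ i)\<bar>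
          \<le> (\<bar>\<alpha> $ i + \<beta> $ i + \<gamma>\<^sub>0\<^sub>1 * (W *v 1) $ i\<bar> + \<bar>\<gamma>\<^sub>1\<^sub>0 - \<gamma>\<^sub>0\<^sub>1\<bar> * (\<bar>R\<bar> * K)) * norm (y - x)"
        unfolding abs_mult abs_minus_cancel
        by (rule mult_mono[OF A yx order_trans[OF abs_ge_zero A] abs_ge_zero])
      have "\<bar>\<gamma>\<^sub>1\<^sub>0 * (1 - x $ i) + \<gamma>\<^sub>0\<^sub>1 * x $ i\<bar> \<le> \<bar>\<gamma>\<^sub>1\<^sub>0 * (1 - x $ i)\<bar> + \<bar>\<gamma>\<^sub>0\<^sub>1 * x $ i\<bar>"
        by (rule abs_triangle_ineq)
      also have "\<dots> \<le> \<gamma>\<^sub>1\<^sub>0 * (1 + \<bar>R\<bar>) + \<gamma>\<^sub>0\<^sub>1 * \<bar>R\<bar>"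
        unfolding abs_mult using x \<gamma>\<^sub>0\<^sub>1_nonneg \<gamma>\<^sub>1\<^sub>0_nonneg
        by (intro add_mono mult_mono) auto
      finally have 2: "\<bar>(\<gamma>\<^sub>1\<^sub>0 * (1 - x $ i) + \<gamma>\<^sub>0\<^sub>1 * x $ i) * (W *v (y - x)) $ i\<bar>
          \<le> (\<gamma>\<^sub>1\<^sub>0 * (1 + \<bar>R\<bar>) + \<gamma>\<^sub>0\<^sub>1 * \<bar>R\<bar>) * (norm (y - x) * K)"
        unfolding abs_mult by (intro mult_mono WK) auto
      have "\<bar>F y $ i - F x $ i\<bar> \<le>
          (\<bar>\<alpha> $ i + \<beta> $ i + \<gamma>\<^sub>0\<^sub>1 * (W *v 1) $ i\<bar> + \<bar>\<gamma>\<^sub>1\<^sub>0 - \<gamma>\<^sub>0\<^sub>1\<bar> * (\<bar>R\<bar> * K)) * norm (y - x)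
          + (\<gamma>\<^sub>1\<^sub>0 * (1 + \<bar>R\<bar>) + \<gamma>\<^sub>0\<^sub>1 * \<bar>R\<bar>) * (norm (y - x) * K)"
        unfolding F_diff by (rule order_trans[OF abs_triangle_ineq add_mono[OF 1 2]])
      also have "\<dots> = C i * norm (y - x)"
        unfolding C_def by algebra
      finally show ?thesis .
    qed
    then have "(\<Sum>i\<in>UNIV. \<bar>(F y - F x) $ i\<bar>) \<le> (\<Sum>i\<in>UNIV. C i * norm (y - x))"
      by (intro sum_mono) simp
    then show "dist (F y) (F x) \<le> (\<Sum>i\<in>UNIV. C i) * dist y x"
      using norm_le_l1_cart[of "F y - F x"] by (simp add: dist_norm sum_distrib_right)
  next
    show "0 \<le> (\<Sum>i\<in>UNIV. C i)"
      using K(1) \<gamma>\<^sub>0\<^sub>1_nonneg \<gamma>\<^sub>1\<^sub>0_nonneg unfolding C_def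
      by (intro sum_nonneg add_nonneg_nonneg mult_nonneg_nonneg) auto
  qed
  then show ?thesis by blast
qed

lemma cube_invariant: "forward_invariant F (cbox 0 1)"
proof (rule unit_cube_invariant_if_inward[OF F_lipschitz])
  show "0 \<le> F p $ i" if "p \<in> cbox 0 1" "p $ i = 0" for p i
    using gain_pos[OF that(1), of i] that(2) by (simp add: F_nth)
  show "F p $ i \<le> 0" if "p \<in> cbox 0 1" "p $ i = 1" for p i
    using loss_pos[OF that(1), of i] that(2) by (simp add: F_nth)
qed

text \<open>
  Solving the \<open>i\<close>-th equation for \<open>p $ i\<close> with the rates held fixed gives the map
  \<open>p \<mapsto> gain / (gain + loss)\<close>. As the rates are strictly positive on the closed cube, it
  takes values in the open cube, so Brouwer's fixed point is automatically interior.
\<close>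

lemma interior_steady_state:
  obtains e where "e \<in> box 0 1" "F e = 0"
proof -
  define f :: "real^'n \<Rightarrow> real^'n" where "f p = (\<chi> i. gain p i / (gain p i + loss p i))" for p
  have f_box: "f p \<in> box 0 1" if "p \<in> cbox 0 1" for p
    using gain_pos[OF that] loss_pos[OF that]
    by (simp add: f_def mem_unit_cube add_pos_pos)
  have W: "continuous_on (cbox 0 1) (\<lambda>p. (W *v p) $ i)" for i
    by (intro continuous_on_component linear_continuous_on matrix_vector_mul_bounded_linear)
  have gain: "continuous_on (cbox 0 1) (\<lambda>p. gain p i)" for i
    unfolding gain_def by (intro continuous_intros W)
  have loss: "continuous_on (cbox 0 1) (\<lambda>p. loss p i)" for i
    unfolding loss_def matrix_vector_mult_diff_distrib vector_minus_component
    by (intro continuous_intros W)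
  have nz: "gain p i + loss p i \<noteq> 0" if "p \<in> cbox 0 1" for p i
    using gain_pos[OF that, of i] loss_pos[OF that, of i] by simp
  have "continuous_on (cbox 0 1) f"
    unfolding f_def
    by (intro continuous_on_vec_lambda continuous_on_divide continuous_on_add gain loss)
      (use nz in auto)
  moreover have "f \<in> cbox 0 1 \<rightarrow> cbox 0 1"
    using f_box box_subset_cbox by blast
  moreover have "cbox 0 (1::real^'n) \<noteq> {}"
    using mem_unit_cube(1)[of "0::real^'n"] by auto
  ultimately obtain e where e: "e \<in> cbox 0 1" "f e = e"
    using brouwer[OF compact_cbox convex_box(1)] by blast
  have "F e = 0"
    unfolding vec_eq_iff
  proof
    fix i
    have "e $ i = gain e i / (gain e i + loss e i)"
      using arg_cong[OF e(2), of "\<lambda>p. p $ i"] by (simp add: f_def)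
    then have "e $ i * (gain e i + loss e i) = gain e i"
      using gain_pos[OF e(1), of i] loss_pos[OF e(1), of i] by (simp add: field_simps)
    then show "F e $ i = 0 $ i" by (simp add: F_nth algebra_simps)
  qed
  with f_box[OF e(1)] e(2) show thesis by (intro that) auto
qed

section \<open>Convergence by barriers along a ray\<close>

lemma solution_in_cube:
  assumes "solves_ode F {0..} p" "p 0 \<in> cbox 0 1" "0 \<le> t"
  shows "0 \<le> p t $ i" "p t $ i \<le> 1"
  using forward_invariantD[OF cube_invariant assms] by (simp_all add: mem_unit_cube)

text \<open>
  The points \<open>(1 + \<mu> * exp (- k * t)) *\<^sub>R e\<close> move along the ray through the steady state
  towards it, at a rate \<open>k\<close> slow enough for sublinearity to make them a supersolution if
  \<open>\<mu> \<ge> 0\<close> and a subsolution if \<open>\<mu> \<le> 0\<close>. Taking \<open>s\<close> to be \<open>1\<close> or \<open>-1\<close>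
  covers the two cases with one argument. The barrier may leave the cube; this is harmless because the coupling
  coefficient in \<open>F_diff\<close> is evaluated at the solution \<open>p\<close>.
\<close>

lemma ray_barrier:
  assumes \<gamma>: "\<gamma>\<^sub>0\<^sub>1 \<le> \<gamma>\<^sub>1\<^sub>0" and e: "e \<in> box 0 1" "F e = 0"
    and k: "\<And>i. k \<le> \<beta> $ i" "0 < k"
    and p: "solves_ode F {0..} p" "p 0 \<in> cbox 0 1"
    and \<mu>: "-1 \<le> \<mu>" "0 \<le> s * \<mu>"
    and init: "\<And>i. s * p 0 $ i \<le> s * ((1 + \<mu>) * e $ i)"
    and t: "0 \<le> t"
  shows "s * p t $ i \<le> s * ((1 + \<mu> * exp (- k * t)) * e $ i)"
proof -
  define r where "r t = 1 + \<mu> * exp (- k * t)" for t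
  define K where "K = \<gamma>\<^sub>1\<^sub>0 * (\<Sum>i\<in>UNIV. \<Sum>j\<in>UNIV. W $ i $ j)"
  have e01: "0 < e $ i" "e $ i < 1" for i using e(1) by (auto simp: mem_unit_cube)
  have We: "0 \<le> (W *v e) $ i" for i
    using e01(1) by (intro W_mult_nonneg less_imp_le)
  have r0: "0 \<le> r u" if "0 \<le> u" for u
  proof -
    have E: "0 \<le> exp (- k * u)" "exp (- k * u) \<le> 1" using k(2) that by auto
    have "-1 * exp (- k * u) \<le> \<mu> * exp (- k * u)"
      using \<mu>(1) by (intro mult_right_mono) auto
    then show ?thesis using E unfolding r_def by linarith
  qed
  have "0 \<le> s * (r t * e $ i - p t $ i)"
  proof (rule quasimonotone_nonneg[where T = t and K = K
        and z = "\<lambda>u i. s * (r u * e $ i - p u $ i)"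
        and z' = "\<lambda>u i. s * (- k * (r u - 1) * e $ i - F (p u) $ i)"])
    fix u i assume u: "0 \<le> u" "u \<le> t"
    have "solves_ode F {0..t} p" using p(1) by (rule solves_ode_subset) auto
    then show "((\<lambda>u. s * (r u * e $ i - p u $ i)) has_real_derivative
        s * (- k * (r u - 1) * e $ i - F (p u) $ i)) (at u within {0..t})"
      unfolding r_def using u
      by (auto intro!: derivative_eq_intros solves_ode_nth_deriv simp: algebra_simps)
    let ?y = "r u *\<^sub>R e"
    let ?z = "\<lambda>j. s * (r u * e $ j - p u $ j)"
    let ?a = "\<alpha> $ i + \<beta> $ i + \<gamma>\<^sub>0\<^sub>1 * (W *v 1) $ i + (\<gamma>\<^sub>1\<^sub>0 - \<gamma>\<^sub>0\<^sub>1) * (W *v ?y) $ i"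
    let ?b = "\<gamma>\<^sub>1\<^sub>0 * (1 - p u $ i) + \<gamma>\<^sub>0\<^sub>1 * p u $ i"
    assume neg: "?z i < 0"
    have pu: "0 \<le> p u $ i" "p u $ i \<le> 1"
      using solution_in_cube[OF p u(1)] by auto
    \<comment> \<open>In \<open>F_diff\<close> the diagonal coefficient \<open>?a\<close> acts on a negative \<open>?z i\<close> and so
      only helps; the coupling coefficient \<open>?b\<close> is bounded by \<open>\<gamma>\<^sub>1\<^sub>0\<close>.\<close>
    have a: "0 \<le> ?a"
      using \<gamma> \<gamma>\<^sub>0\<^sub>1_nonneg \<alpha>_pos[of i] \<beta>_pos[of i] r0[OF u(1)] e01(1)
      by (intro add_nonneg_nonneg mult_nonneg_nonneg W_mult_nonneg) (auto simp: less_imp_le)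
    have b0: "0 \<le> ?b"
      using pu \<gamma>\<^sub>0\<^sub>1_nonneg \<gamma>\<^sub>1\<^sub>0_nonneg by simp
    have "\<gamma>\<^sub>0\<^sub>1 * p u $ i \<le> \<gamma>\<^sub>1\<^sub>0 * p u $ i" using \<gamma> pu(1) by (rule mult_right_mono)
    then have b1: "?b \<le> \<gamma>\<^sub>1\<^sub>0" by (simp add: algebra_simps)
    \<comment> \<open>The barrier is a super- or subsolution: the gain \<open>\<beta>\<close> from sublinearity pays for its
      speed \<open>k * e $ i\<close>.\<close>
    have "k * e $ i \<le> k * 1" using k(2) e01(2)[of i] by (intro mult_left_mono) auto
    then have "0 \<le> \<beta> $ i - k * e $ i" using k(1)[of i] by simp
    moreover have "0 \<le> (\<gamma>\<^sub>1\<^sub>0 - \<gamma>\<^sub>0\<^sub>1) * r u * (e $ i * (W *v e) $ i)"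
      using \<gamma> r0[OF u(1)] e01(1)[of i] We[of i] by (intro mult_nonneg_nonneg) auto
    ultimately have "0 \<le> (s * \<mu>) * (exp (- k * u) *
        ((\<beta> $ i - k * e $ i) + (\<gamma>\<^sub>1\<^sub>0 - \<gamma>\<^sub>0\<^sub>1) * r u * (e $ i * (W *v e) $ i)))"
      using \<mu>(2) by (intro mult_nonneg_nonneg[of "s * \<mu>"] mult_nonneg_nonneg[of "exp (- k * u)"]) auto
    also have "\<dots> = s * (- k * (r u - 1) * e $ i - F ?y $ i)"
    proof -
      have r: "r u - 1 = \<mu> * exp (- k * u)" by (simp add: r_def)
      have "F ?y $ i = - (r u - 1) * (\<beta> $ i + (\<gamma>\<^sub>1\<^sub>0 - \<gamma>\<^sub>0\<^sub>1) * r u * (e $ i * (W *v e) $ i))"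
        using F_scale[of "r u" e i] e(2) by (simp add: mult.assoc)
      then show ?thesis unfolding r by algebra
    qed
    finally have super: "0 \<le> s * (- k * (r u - 1) * e $ i - F ?y $ i)" .
    have "s * (F ?y $ i - F (p u) $ i) = - ?a * ?z i + ?b * (\<Sum>j\<in>UNIV. W $ i $ j * ?z j)"
    proof -
      have "s * (W *v (?y - p u)) $ i = (\<Sum>j\<in>UNIV. W $ i $ j * ?z j)"
        by (simp add: matrix_vector_mult_def sum_distrib_left mult.left_commute)
      moreover have "s * (F ?y $ i - F (p u) $ i)
          = - ?a * (s * (?y $ i - p u $ i)) + ?b * (s * (W *v (?y - p u)) $ i)"
        unfolding F_diff by (simp only: distrib_left mult.left_commute)
      ultimately show ?thesis by simp
    qed
    moreover have "0 \<le> - ?a * ?z i"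
      using a neg by (intro mult_nonpos_nonpos) auto
    moreover have "K * (\<Sum>j\<in>UNIV. min (?z j) 0) \<le> ?b * (\<Sum>j\<in>UNIV. W $ i $ j * ?z j)"
    proof -
      have "K * min (?z j) 0 \<le> ?b * (W $ i $ j * ?z j)" for j
      proof -
        have "W $ i $ j \<le> (\<Sum>j\<in>UNIV. W $ i $ j)"
          by (rule member_le_sum) (auto simp: W_nonneg)
        also have "\<dots> \<le> (\<Sum>i\<in>UNIV. \<Sum>j\<in>UNIV. W $ i $ j)"
          by (rule member_le_sum) (auto simp: W_nonneg sum_nonneg)
        finally have "?b * W $ i $ j \<le> K"
          unfolding K_def using b0 b1 \<gamma>\<^sub>1\<^sub>0_nonneg W_nonneg by (intro mult_mono) auto
        then have "K * min (?z j) 0 \<le> (?b * W $ i $ j) * min (?z j) 0"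
          by (rule mult_right_mono_neg) simp
        also have "\<dots> \<le> (?b * W $ i $ j) * ?z j"
          using b0 W_nonneg by (intro mult_left_mono) auto
        finally show ?thesis by (simp add: mult.assoc)
      qed
      then show ?thesis
        unfolding sum_distrib_left by (rule sum_mono)
    qed
    ultimately have "K * (\<Sum>j\<in>UNIV. min (?z j) 0) \<le> s * (F ?y $ i - F (p u) $ i)"
      by linarith
    then show "K * (\<Sum>j\<in>UNIV. min (?z j) 0) \<le> s * (- k * (r u - 1) * e $ i - F (p u) $ i)"
      using super unfolding right_diff_distrib by linarith
  next
    show "0 \<le> K"
      unfolding K_def using \<gamma>\<^sub>1\<^sub>0_nonneg W_nonneg by (intro mult_nonneg_nonneg sum_nonneg) auto
    show "0 \<le> s * (r 0 * e $ i - p 0 $ i)" for i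
      using init[of i] by (simp add: r_def algebra_simps)
  qed (rule t)
  then show ?thesis by (simp add: r_def algebra_simps)
qed

text \<open>
  The solution is trapped between two barriers that both shrink to \<open>e\<close>.
\<close>

lemma relative_deviation_decay:
  assumes \<gamma>: "\<gamma>\<^sub>0\<^sub>1 \<le> \<gamma>\<^sub>1\<^sub>0" and e: "e \<in> box 0 1" "F e = 0"
    and k: "\<And>i. k \<le> \<beta> $ i" "0 < k"
    and p: "solves_ode F {0..} p" "p 0 \<in> cbox 0 1"
    and \<eta>: "0 \<le> \<eta>" and init: "\<And>i. \<bar>p 0 $ i - e $ i\<bar> \<le> \<eta> * e $ i"
    and t: "0 \<le> t"
  shows "\<bar>p t $ i - e $ i\<bar> \<le> \<eta> * exp (- k * t) * e $ i"
proof -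
  have e0: "0 < e $ i" for i using e(1) by (auto simp: mem_unit_cube)
  have p0: "0 \<le> p 0 $ i" for i using p(2) by (auto simp: mem_unit_cube)
  have upper: "1 * p t $ i \<le> 1 * ((1 + \<eta> * exp (- k * t)) * e $ i)"
  proof (rule ray_barrier[OF \<gamma> e k p])
    show "1 * p 0 $ i \<le> 1 * ((1 + \<eta>) * e $ i)" for i
      using init[of i] by (simp add: algebra_simps)
  qed (use \<eta> t in auto)
  \<comment> \<open>The lower barrier must not start below the origin. For \<open>\<eta> \<ge> 1\<close> it starts at \<open>0\<close>, which
    is below \<open>p 0\<close> because \<open>p 0\<close> lies in the cube.\<close>
  define \<mu> where "\<mu> = - min \<eta> 1"
  have lower: "-1 * p t $ i \<le> -1 * ((1 + \<mu> * exp (- k * t)) * e $ i)"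
  proof (rule ray_barrier[OF \<gamma> e k p])
    show "-1 * p 0 $ i \<le> -1 * ((1 + \<mu>) * e $ i)" for i
      using init[of i] p0[of i] by (auto simp: \<mu>_def min_def algebra_simps)
  qed (use \<eta> t in \<open>auto simp: \<mu>_def\<close>)
  have "- \<mu> * (exp (- k * t) * e $ i) \<le> \<eta> * (exp (- k * t) * e $ i)"
    using e0[of i] by (intro mult_right_mono) (auto simp: \<mu>_def less_imp_le)
  with upper lower show ?thesis
    by (simp add: algebra_simps abs_le_iff)
qed

text \<open>
  The relative deviation \<open>max\<^sub>i \<bar>p $ i - e $ i\<bar> / e $ i\<close> is comparable to the distance from
  \<open>e\<close> because \<open>e\<close> is bounded away from \<open>0\<close>, so the decay of the former becomes an
  exponential bound for the latter.
\<close>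

lemma steady_state_globally_stable:
  assumes \<gamma>: "\<gamma>\<^sub>0\<^sub>1 \<le> \<gamma>\<^sub>1\<^sub>0" and e: "e \<in> box 0 1" "F e = 0"
  shows "globally_stable F (cbox 0 1) e"
proof -
  have e01: "0 < e $ i" "e $ i < 1" for i using e(1) by (auto simp: mem_unit_cube)
  define k where "k = Min (range (($) \<beta>))"
  define c where "c = Min (range (($) e))"
  have k: "k \<le> \<beta> $ i" "0 < k" for i by (auto simp: k_def \<beta>_pos)
  have c: "c \<le> e $ i" "0 < c" for i by (auto simp: c_def e01)
  show ?thesis
  proof (rule globally_stable_if_exponential[OF k(2)])
    show "0 < real CARD('n) / c" using c(2) by simp
    fix p :: "real \<Rightarrow> real^'n" and t :: real
    assume p: "solves_ode F {0..} p" "p 0 \<in> cbox 0 1" and t: "0 \<le> t"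
    define \<eta> where "\<eta> = dist (p 0) e / c"
    have \<eta>: "0 \<le> \<eta>" using c(2) by (simp add: \<eta>_def)
    have init: "\<bar>p 0 $ i - e $ i\<bar> \<le> \<eta> * e $ i" for i
    proof -
      have "\<bar>p 0 $ i - e $ i\<bar> \<le> \<eta> * c"
        using component_le_norm_cart[of "p 0 - e" i] c(2) by (simp add: \<eta>_def dist_norm)
      also have "\<dots> \<le> \<eta> * e $ i" using c(1) \<eta> by (rule mult_left_mono)
      finally show ?thesis .
    qed
    have "\<bar>p t $ i - e $ i\<bar> \<le> \<eta> * exp (- k * t)" for i
    proof -
      have "\<bar>p t $ i - e $ i\<bar> \<le> \<eta> * exp (- k * t) * e $ i"
        by (rule relative_deviation_decay[OF \<gamma> e k p \<eta> init t])
      also have "\<dots> \<le> \<eta> * exp (- k * t) * 1"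
        using \<eta> e01(2)[of i] by (intro mult_left_mono) auto
      finally show ?thesis by simp
    qed
    then have "(\<Sum>i\<in>UNIV. \<bar>(p t - e) $ i\<bar>) \<le> (\<Sum>i\<in>(UNIV :: 'n set). \<eta> * exp (- k * t))"
      by (intro sum_mono) simp
    then show "dist (p t) e \<le> real CARD('n) / c * dist (p 0) e * exp (- k * t)"
      using norm_le_l1_cart[of "p t - e"] by (simp add: dist_norm \<eta>_def)
  qed
qed

end

section \<open>Exchange of \<open>p\<close> and \<open>q\<close>, and the theorem\<close>

lemma network_field_reflect:
  "network_field \<beta> \<alpha> \<gamma>\<^sub>1\<^sub>0 \<gamma>\<^sub>0\<^sub>1 W (1 - p) = - network_field \<alpha> \<beta> \<gamma>\<^sub>0\<^sub>1 \<gamma>\<^sub>1\<^sub>0 W p"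
  by (simp add: network_field_def vec_eq_iff)

theorem theorem3p1:
  fixes \<alpha> \<beta> :: "real^'n" and \<gamma>\<^sub>0\<^sub>1 \<gamma>\<^sub>1\<^sub>0 :: real and W :: "real^'n^'n"
  assumes "\<And>i. \<alpha> $ i > 0"
    and "\<And>i. \<beta> $ i > 0"
    and "\<gamma>\<^sub>0\<^sub>1 \<ge> 0"
    and "\<gamma>\<^sub>1\<^sub>0 \<ge> 0"
    and "transpose W = W"
    and "\<And>i j. W $ i $ j \<ge> 0"
    and "\<And>i. W $ i $ i = 0"
  defines "F \<equiv> network_field \<alpha> \<beta> \<gamma>\<^sub>0\<^sub>1 \<gamma>\<^sub>1\<^sub>0 W"
  shows "forward_invariant F (cbox 0 1) \<and>
    (\<exists>e \<in> box 0 1. steady_state F e \<and> globally_stable F (cbox 0 1) e \<and>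
      (\<forall>e' \<in> box 0 1. steady_state F e' \<longrightarrow> e' = e))"
proof -
  interpret cooperative_network \<alpha> \<beta> \<gamma>\<^sub>0\<^sub>1 \<gamma>\<^sub>1\<^sub>0 W
    by (rule cooperative_network.intro[OF assms(1-4,6)])
  interpret dual: cooperative_network \<beta> \<alpha> \<gamma>\<^sub>1\<^sub>0 \<gamma>\<^sub>0\<^sub>1 W
    by (rule cooperative_network.intro[OF assms(2,1,4,3,6)])
  obtain e where e: "e \<in> box 0 1" "F e = 0"
    unfolding F_def by (rule interior_steady_state)
  have stable: "globally_stable F (cbox 0 1) e"
  proof (cases "\<gamma>\<^sub>0\<^sub>1 \<le> \<gamma>\<^sub>1\<^sub>0")
    case True
    then show ?thesis
      using e unfolding F_def by (rule steady_state_globally_stable)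
  next
    case False
    have "globally_stable (network_field \<beta> \<alpha> \<gamma>\<^sub>1\<^sub>0 \<gamma>\<^sub>0\<^sub>1 W) (cbox 0 1) (1 - e)"
    proof (rule dual.steady_state_globally_stable)
      show "1 - e \<in> box 0 1" using e(1) by (simp add: mem_unit_cube)
      show "network_field \<beta> \<alpha> \<gamma>\<^sub>1\<^sub>0 \<gamma>\<^sub>0\<^sub>1 W (1 - e) = 0"
        using e(2) by (simp add: network_field_reflect F_def)
    qed (use False in simp)
    then have "globally_stable F (cbox 0 1) (1 - (1 - e))"
      by (rule globally_stable_reflect) (auto simp: F_def network_field_reflect mem_unit_cube)
    then show ?thesis by simp
  qed
  moreover have "e' = e" if "e' \<in> box 0 1" "steady_state F e'" for e'
    using globally_stable_steady_state_unique[OF stable _ that(2)] that(1) box_subset_cbox by blast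
  ultimately show ?thesis
    using cube_invariant e unfolding F_def steady_state_def by blast
qed

end
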